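(* Let $k\ge 1$ and let $1\le s_1<s_2<\ldots<s_k$ be fixed integers. For each integer $n$ with $s_k<\frac{n}{2}$, let $f_G(n)$ be the number of rooted spanning forests in the circulant graph $G=C_{n}(s_1,s_2,\ldots,s_k)$. Then $$f_{G}(n)\sim A^n\quad\text{as } n\to\infty,$$ where $A=\exp\left(\int_0^1\log(P(e^{2\pi i t}))\,dt\right)$ is the Mahler measure of the Laurent polynomial $P(z)=2k+1-\sum_{i=1}^k(z^{s_i}+z^{-s_i})$.
   Context: The circulant graph $C_{n}(s_1,\ldots,s_k)$ (with $1\le s_1<\ldots<s_k\le \frac n2$) is the simple undirected graph with vertices $0,1,\ldots,n-1$ in which each vertex $i$ is adjacent to the vertices $i\pm s_1, i\pm s_2,\ldots,i\pm s_k \pmod n$. A rooted spanning forest of a graph is a spanning acyclic subgraph (containing all the vertices) together with a choice of one distinguished vertex (root) in each connected component. The Mahler measure of a Laurent polynomial $P(z)=a_s z^{m}\prod_{i=1}^{s}(z-\alpha_i)$ with complex coefficients ($a_s\ne 0$, $m\in\mathbb{Z}$) is $M(P)=\exp\left(\int_0^1\log|P(e^{2\pi i t})|\,dt\right)$, equivalently $M(P)=|a_s|\prod_{|\alpha_i|>1}|\alpha_i|$. The notation $f(n)\sim g(n)$ means $f(n)/g(n)\to 1$ as $n\to\infty$. *)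

theory Defs
  imports "HOL-Analysis.Analysis" "HOL-Library.Landau_Symbols"
begin

text \<open>
  An undirected graph is a set of vertices with a set of edges, an edge being the set of its
  two endpoints. This is used instead of symmetric digraphs because in a symmetric digraph
  every edge already yields a directed cycle of length 2, so that digraph notions of acyclicity
  do not describe undirected forests.
\<close>

record 'a ugraph =
  uverts :: "'a set"
  uedges :: "'a set set"

text \<open>
  \<open>S\<close> is the set of jumps. For \<open>1 \<le> a \<le> n / 2\<close> for all \<open>a \<in> S\<close> every edge has two distinct
  endpoints, both below \<open>n\<close>. The computation is in \<^typ>\<open>int\<close> because subtraction on
  \<^typ>\<open>nat\<close> truncates.
\<close>

definition circulant_graph :: "nat \<Rightarrow> nat set \<Rightarrow> nat ugraph" where
  "circulant_graph n S =
     \<lparr> uverts = {0..<n},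
       uedges = {{u, v} | u v. u < n \<and>
         (\<exists>a\<in>S. int v = (int u + int a) mod int n \<or> int v = (int u - int a) mod int n)} \<rparr>"

definition ugraph_cycle :: "'a ugraph \<Rightarrow> 'a list \<Rightarrow> bool" where
  "ugraph_cycle G p \<longleftrightarrow> length p \<ge> 3 \<and> distinct p \<and>
     (\<forall>i<length p. {p ! i, p ! ((i + 1) mod length p)} \<in> uedges G)"

definition ugraph_acyclic :: "'a ugraph \<Rightarrow> bool" where
  "ugraph_acyclic G \<longleftrightarrow> \<not> (\<exists>p. ugraph_cycle G p)"

definition ugraph_components :: "'a ugraph \<Rightarrow> 'a set set" where
  "ugraph_components G = uverts G // {(u, v). {u, v} \<in> uedges G}\<^sup>*"

text \<open>
  A spanning subgraph has all the vertices, so it is given by its edge set \<open>F\<close>; the choice of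
  one root in every component is given by the set \<open>R\<close> of all roots.
\<close>

definition rooted_spanning_forests :: "'a ugraph \<Rightarrow> ('a set set \<times> 'a set) set" where
  "rooted_spanning_forests G =
     {(F, R). F \<subseteq> uedges G \<and> ugraph_acyclic \<lparr> uverts = uverts G, uedges = F \<rparr> \<and>
        R \<subseteq> uverts G \<and>
        (\<forall>C \<in> ugraph_components \<lparr> uverts = uverts G, uedges = F \<rparr>. \<exists>!r. r \<in> C \<inter> R)}"

text \<open>
  A Laurent polynomial is represented by the function it induces on the nonzero complex numbers.
\<close>

definition laurent_mahler_measure :: "(complex \<Rightarrow> complex) \<Rightarrow> real" where
  "laurent_mahler_measure P =
     exp (integral {0..1} (\<lambda>t. ln (cmod (P (exp (2 * of_real pi * \<i> * of_real t))))))"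

definition circulant_laurent :: "nat \<Rightarrow> (nat \<Rightarrow> nat) \<Rightarrow> complex \<Rightarrow> complex" where
  "circulant_laurent k s z =
     of_nat (2 * k + 1) - (\<Sum>i=1..k. z powi int (s i) + z powi (- int (s i)))"

end

theory Submission
  imports Defs "Jordan_Normal_Form.Determinant"
begin

text \<open>
  By the matrix forest theorem, the number of rooted spanning forests of a finite graph is the
  determinant of \<open>I + L\<close>, where \<open>L\<close> is the Laplacian. For a circulant graph this matrix is
  diagonalised by the vectors \<open>(1, z, z\<^sup>2, \<dots>)\<close> for the \<open>n\<close>-th roots of unity \<open>z\<close>, with eigenvalues
  \<open>P z\<close>; so the number of forests is the product of the values of \<open>P\<close> at the \<open>n\<close>-th roots of unity
  (\<open>card_forests_circulant\<close>).

  At \<open>exp (2 \<pi> \<i> t)\<close> the polynomial takes the real value \<open>q t = 1 + (\<Sum>a\<in>S. 2 - 2 cos (2 \<pi> a t))\<close>,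
  which is at least 1. Hence \<open>g = ln q\<close> is smooth and periodic, the logarithm of the number of
  forests is \<open>\<Sum>j<n. g (j / n)\<close>, and the logarithm of the \<open>n\<close>-th power of the Mahler measure is \<open>n\<close>
  times the integral of \<open>g\<close>. For periodic \<open>g\<close> the Riemann sum is a trapezoidal sum, so that
  the difference of these two logarithms is of order \<open>1 / n\<close>
  (\<open>periodic_riemann_sum_error_tendsto_0\<close>), and the quotient of the two quantities tends to 1.

  The matrix forest theorem is proved by orienting each forest towards its roots. A rooted forest
  is then a choice, for each vertex, of a parent among its neighbours or of being a root, such that
  following the parents always ends in a root. Expanding \<open>det (I + L)\<close> by multilinearity in the
  rows gives one determinant for each choice, with or without this property; the determinant is 1
  if the choice is a forest, since only the identity permutation contributes, and 0 if it contains
  a cycle, since the vertices that never reach a root give a vector in the kernel.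
\<close>

section \<open>Iterating a parent function\<close>

text \<open>
  A rooted forest is encoded by the function sending each vertex to its parent and each root to
  itself. Walking to a root is then plain iteration, and the function encodes a forest exactly if
  every such walk ends in a fixed point.
\<close>
definition eventually_fixed :: "('a \<Rightarrow> 'a) \<Rightarrow> 'a \<Rightarrow> bool" where
  "eventually_fixed p v \<longleftrightarrow> (\<exists>m. p ((p ^^ m) v) = (p ^^ m) v)"

definition height :: "('a \<Rightarrow> 'a) \<Rightarrow> 'a \<Rightarrow> nat" where
  "height p v = (LEAST m. p ((p ^^ m) v) = (p ^^ m) v)"

definition root_of :: "('a \<Rightarrow> 'a) \<Rightarrow> 'a \<Rightarrow> 'a" where
  "root_of p v = (p ^^ height p v) v"

lemma eventually_fixed_fixpoint: "p v = v \<Longrightarrow> eventually_fixed p v"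
  unfolding eventually_fixed_def by (intro exI[of _ 0]) simp

lemma eventually_fixed_step: "eventually_fixed p (p v) \<longleftrightarrow> eventually_fixed p v"
proof
  assume "eventually_fixed p (p v)"
  then obtain m where "p ((p ^^ m) (p v)) = (p ^^ m) (p v)"
    unfolding eventually_fixed_def by blast
  then show "eventually_fixed p v"
    unfolding eventually_fixed_def by (intro exI[of _ "Suc m"]) (simp add: funpow_swap1)
next
  assume "eventually_fixed p v"
  then obtain m where "p ((p ^^ m) v) = (p ^^ m) v"
    unfolding eventually_fixed_def by blast
  then show "eventually_fixed p (p v)"
    unfolding eventually_fixed_def by (intro exI[of _ m]) (metis funpow_swap1)
qed

lemma height_fixpoint: "p v = v \<Longrightarrow> height p v = 0"
  unfolding height_def by (intro Least_equality) auto

lemma root_of_fixpoint: "p v = v \<Longrightarrow> root_of p v = v"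
  by (simp add: root_of_def height_fixpoint)

lemma height_step:
  assumes "eventually_fixed p v" "p v \<noteq> v"
  shows "height p v = Suc (height p (p v))"
proof -
  obtain m where "p ((p ^^ m) v) = (p ^^ m) v"
    using assms(1) unfolding eventually_fixed_def by blast
  then have "height p v = Suc (LEAST m. p ((p ^^ Suc m) v) = (p ^^ Suc m) v)"
    unfolding height_def using assms(2) by (intro Least_Suc) auto
  then show ?thesis
    unfolding height_def by (simp add: funpow_swap1)
qed

lemma root_of_step:
  assumes "eventually_fixed p v"
  shows "root_of p (p v) = root_of p v"
proof (cases "p v = v")
  case False
  then show ?thesis
    using height_step[OF assms False] by (simp add: root_of_def funpow_swap1)
qed simp

text \<open>
  Induction from the roots towards the leaves; it is well-founded because the height drops from
  a vertex to its parent.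
\<close>
lemma eventually_fixed_induct [consumes 1, case_names root child]:
  assumes "eventually_fixed p v"
    and root: "\<And>v. p v = v \<Longrightarrow> Q v"
    and child: "\<And>v. eventually_fixed p (p v) \<Longrightarrow> p v \<noteq> v \<Longrightarrow> Q (p v) \<Longrightarrow> Q v"
  shows "Q v"
  using assms(1)
proof (induction "height p v" arbitrary: v rule: less_induct)
  case less
  show ?case
  proof (cases "p v = v")
    case False
    then show ?thesis
      using less.hyps[of "p v"] less.prems height_step[OF less.prems False]
      by (auto simp: eventually_fixed_step intro!: child[of v])
  qed (rule root)
qed

lemma eventually_fixed_no_2_cycle:
  assumes "eventually_fixed p v" "p (p v) = v"
  shows "p v = v"
proof (rule ccontr)
  assume "p v \<noteq> v"
  then show False
    using height_step[OF assms(1)] height_step[of p "p v"] assms by (auto simp: eventually_fixed_step)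
qed

section \<open>Simple paths and bridges\<close>
lemma rtrancl_imp_simple_path:
  assumes "(u, v) \<in> E\<^sup>*"
  shows "\<exists>p. p \<noteq> [] \<and> distinct p \<and> hd p = u \<and> last p = v \<and> successively (\<lambda>x y. (x, y) \<in> E) p"
  using assms
proof (induction rule: converse_rtrancl_induct)
  case base
  then show ?case by (intro exI[of _ "[v]"]) simp
next
  case (step u w)
  then obtain p where p: "p \<noteq> []" "distinct p" "hd p = w" "last p = v"
      "successively (\<lambda>x y. (x, y) \<in> E) p" by blast
  show ?case
  proof (cases "u \<in> set p")
    case True
    then obtain a b where ab: "p = a @ u # b" by (auto simp: in_set_conv_decomp)
    then show ?thesis
      using p by (intro exI[of _ "u # b"]) (auto simp: successively_append_iff)
  next
    case False
    then show ?thesis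
      using p step.hyps by (intro exI[of _ "u # p"]) (auto simp: successively_Cons)
  qed
qed

text \<open>
  A simple path from \<open>u\<close> to \<open>v\<close> that avoids the edge \<open>{u, v}\<close> has a third vertex, and the edge
  closes it to a cycle.
\<close>
lemma acyclic_edge_is_bridge:
  assumes acyc: "ugraph_acyclic \<lparr>uverts = V, uedges = F\<rparr>"
    and e: "{u, v} \<in> F" and ne: "u \<noteq> v"
    and conn: "(u, v) \<in> {(x, y). {x, y} \<in> F - {{u, v}}}\<^sup>*"
  shows False
proof -
  obtain p where p: "p \<noteq> []" "distinct p" "hd p = u" "last p = v"
    and succ: "successively (\<lambda>x y. (x, y) \<in> {(x, y). {x, y} \<in> F - {{u, v}}}) p"
    using rtrancl_imp_simple_path[OF conn] by blast
  have len: "length p \<ge> 3"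
  proof (rule ccontr)
    assume "\<not> length p \<ge> 3"
    then consider x where "p = [x]" | x y where "p = [x, y]"
      using p(1) by (cases p rule: remdups_adj.cases) (auto simp: Suc_le_eq numeral_3_eq_3)
    then show False using p ne succ by cases auto
  qed
  \<comment> \<open>The step that wraps around from the last to the first entry is the removed edge itself.\<close>
  have "{p ! i, p ! ((i + 1) mod length p)} \<in> F" if i: "i < length p" for i
  proof (cases "Suc i = length p")
    case True
    then have "i = length p - 1" by simp
    then have "p ! i = v" "p ! 0 = u"
      using p by (simp_all add: last_conv_nth hd_conv_nth)
    then show ?thesis using True e by (simp add: insert_commute)
  next
    case False
    then have "Suc i < length p" using i by simp
    then show ?thesis using succ by (auto simp: successively_conv_nth)
  qed
  then have "ugraph_cycle \<lparr>uverts = V, uedges = F\<rparr> p"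
    unfolding ugraph_cycle_def using len p(2) by simp
  then show False using acyc unfolding ugraph_acyclic_def by blast
qed

section \<open>Rooted spanning forests as parent functions\<close>
locale loopless_graph =
  fixes G :: "'a ugraph"
  assumes edge_ends: "e \<in> uedges G \<Longrightarrow> \<exists>u v. e = {u, v} \<and> u \<noteq> v \<and> u \<in> uverts G \<and> v \<in> uverts G"
begin

definition parent_functions :: "('a \<Rightarrow> 'a) set" where
  "parent_functions = {p \<in> uverts G \<rightarrow>\<^sub>E uverts G. \<forall>v\<in>uverts G. p v = v \<or> {v, p v} \<in> uedges G}"

definition forest_parents :: "('a \<Rightarrow> 'a) set" where
  "forest_parents = {p \<in> parent_functions. \<forall>v\<in>uverts G. eventually_fixed p v}"

definition parent_edges :: "('a \<Rightarrow> 'a) \<Rightarrow> 'a set set" where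
  "parent_edges p = {{v, p v} | v. v \<in> uverts G \<and> p v \<noteq> v}"

definition parent_roots :: "('a \<Rightarrow> 'a) \<Rightarrow> 'a set" where
  "parent_roots p = {v \<in> uverts G. p v = v}"

lemma edgeD: "{u, v} \<in> uedges G \<Longrightarrow> u \<noteq> v \<and> u \<in> uverts G \<and> v \<in> uverts G"
  using edge_ends[of "{u, v}"] by (auto simp: doubleton_eq_iff)

lemma parent_in_verts: "p \<in> forest_parents \<Longrightarrow> v \<in> uverts G \<Longrightarrow> p v \<in> uverts G"
  unfolding forest_parents_def parent_functions_def by auto

lemma forest_parents_fixed: "p \<in> forest_parents \<Longrightarrow> v \<in> uverts G \<Longrightarrow> eventually_fixed p v"
  unfolding forest_parents_def by auto

lemma parent_edges_iff:
  "{u, v} \<in> parent_edges p \<longleftrightarrow> u \<in> uverts G \<and> p u \<noteq> u \<and> v = p u \<or> v \<in> uverts G \<and> p v \<noteq> v \<and> u = p v"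
  unfolding parent_edges_def by (auto simp: doubleton_eq_iff)

text \<open>
  On a cycle, a vertex of maximal height is joined to both of its neighbours by edges to its
  parent, so these two neighbours coincide.
\<close>
lemma parent_edges_acyclic:
  assumes p: "p \<in> forest_parents"
  shows "ugraph_acyclic \<lparr>uverts = uverts G, uedges = parent_edges p\<rparr>"
  unfolding ugraph_acyclic_def
proof
  assume "\<exists>c. ugraph_cycle \<lparr>uverts = uverts G, uedges = parent_edges p\<rparr> c"
  then obtain c where len: "length c \<ge> 3" and dist: "distinct c"
    and adj: "\<And>i. i < length c \<Longrightarrow> {c ! i, c ! ((i + 1) mod length c)} \<in> parent_edges p"
    unfolding ugraph_cycle_def by auto
  define l where "l = length c"
  have l: "l \<ge> 3" using len l_def by simp
  have towards: "y = p x" if "{x, y} \<in> parent_edges p" "height p y \<le> height p x" for x y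
  proof (rule ccontr)
    assume "y \<noteq> p x"
    then have "y \<in> uverts G" "p y \<noteq> y" "x = p y" using that(1) parent_edges_iff by auto
    then show False using height_step[of p y] forest_parents_fixed[OF p] that(2) by auto
  qed
  obtain i where i: "i < l" and mx: "\<And>j. j < l \<Longrightarrow> height p (c ! j) \<le> height p (c ! i)"
  proof -
    define H where "H = (\<lambda>j. height p (c ! j)) ` {..<l}"
    have H: "finite H" "H \<noteq> {}" using l by (auto simp: H_def lessThan_empty_iff)
    obtain i where "i < l" "Max H = height p (c ! i)"
      using Max_in[OF H] unfolding H_def by blast
    moreover have "height p (c ! j) \<le> Max H" if "j < l" for j
      using that H by (intro Max_ge) (auto simp: H_def)
    ultimately show ?thesis using that by metis
  qed
  define j where "j = (if Suc i = l then 0 else Suc i)"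
  define h where "h = (if i = 0 then l - 1 else i - 1)"
  have j: "(i + 1) mod l = j" using i by (auto simp: j_def)
  have h: "(h + 1) mod l = i" using i by (auto simp: h_def)
  have jh: "j < l" "h < l" "j \<noteq> h" using i l by (auto simp: j_def h_def split: if_splits)
  have "{c ! i, c ! j} \<in> parent_edges p" using adj[of i] i j by (simp add: l_def)
  then have 1: "c ! j = p (c ! i)" using towards mx jh by blast
  have "{c ! i, c ! h} \<in> parent_edges p"
    using adj[of h] jh h by (simp add: l_def insert_commute)
  then have "c ! h = p (c ! i)" using towards mx jh by blast
  then have "c ! j = c ! h" using 1 by simp
  then show False using dist jh by (auto simp: l_def nth_eq_iff_index_eq)
qed

text \<open>
  Since an edge joins a vertex to its parent, the root reached is an invariant of the component;
  this is why a component contains only one root.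
\<close>
lemma root_of_component:
  assumes p: "p \<in> forest_parents"
    and "(u, v) \<in> {(x, y). {x, y} \<in> parent_edges p}\<^sup>*"
  shows "root_of p u = root_of p v"
  using assms(2)
proof (induction rule: rtrancl_induct)
  case (step x y)
  then have "root_of p x = root_of p y"
    using root_of_step[of p] forest_parents_fixed[OF p] by (auto simp: parent_edges_iff)
  then show ?case using step by simp
qed simp

lemma root_of_reachable:
  assumes p: "p \<in> forest_parents" and v: "v \<in> uverts G"
  shows "root_of p v \<in> parent_roots p \<and> (v, root_of p v) \<in> {(x, y). {x, y} \<in> parent_edges p}\<^sup>*"
  using forest_parents_fixed[OF p v] v
proof (induction rule: eventually_fixed_induct)
  case (root v)
  then show ?case by (simp add: root_of_fixpoint parent_roots_def)
next
  case (child v)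
  have "{v, p v} \<in> parent_edges p" using child by (auto simp: parent_edges_iff)
  then have "(v, p v) \<in> {(x, y). {x, y} \<in> parent_edges p}" by simp
  moreover have "root_of p (p v) = root_of p v"
    using child.hyps(1) by (intro root_of_step) (simp only: eventually_fixed_step)
  moreover have "p v \<in> uverts G" using parent_in_verts[OF p child.prems] .
  ultimately show ?case
    using child.IH by (metis (no_types, lifting) converse_rtrancl_into_rtrancl)
qed

lemma forest_of_parents:
  assumes p: "p \<in> forest_parents"
  shows "(parent_edges p, parent_roots p) \<in> rooted_spanning_forests G"
proof -
  have "parent_edges p \<subseteq> uedges G"
    using p unfolding parent_edges_def forest_parents_def parent_functions_def by auto
  moreover have "\<exists>!r. r \<in> C \<inter> parent_roots p"
    if C: "C \<in> ugraph_components \<lparr>uverts = uverts G, uedges = parent_edges p\<rparr>" for C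
  proof -
    obtain x where x: "x \<in> uverts G" and Cx: "C = {(u, v). {u, v} \<in> parent_edges p}\<^sup>* `` {x}"
      using C unfolding ugraph_components_def by (auto elim: quotientE)
    show ?thesis
    proof (rule ex1I[of _ "root_of p x"])
      show "root_of p x \<in> C \<inter> parent_roots p" using root_of_reachable[OF p x] Cx by auto
      fix r assume "r \<in> C \<inter> parent_roots p"
      then have "root_of p x = root_of p r" "p r = r"
        using root_of_component[OF p] Cx by (auto simp: parent_roots_def)
      then show "r = root_of p x" by (simp add: root_of_fixpoint)
    qed
  qed
  ultimately show ?thesis
    unfolding rooted_spanning_forests_def using parent_edges_acyclic[OF p]
    by (auto simp: parent_roots_def)
qed

text \<open>
  The edges and the roots fix the orientation: going up from the roots, an edge from \<open>v\<close> to its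
  parent in \<open>p\<close> cannot be oriented the other way round in \<open>q\<close>, since \<open>p\<close> and \<open>q\<close> agree at that
  parent and would then have a cycle of length 2.
\<close>
lemma forest_determines_parents:
  assumes p: "p \<in> forest_parents" and q: "q \<in> forest_parents"
    and edges: "parent_edges p = parent_edges q" and roots: "parent_roots p = parent_roots q"
  shows "p = q"
proof
  fix v
  show "p v = q v"
  proof (cases "v \<in> uverts G")
    case True
    from forest_parents_fixed[OF p True] True show ?thesis
    proof (induction rule: eventually_fixed_induct)
      case (root v)
      then have "v \<in> parent_roots q" using roots by (auto simp: parent_roots_def)
      then show ?case using root by (simp add: parent_roots_def)
    next
      case (child v)
      have IH: "p (p v) = q (p v)" using child parent_in_verts[OF p] by blast
      have "{v, p v} \<in> parent_edges p" using child by (auto simp: parent_edges_iff)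
      then have "{v, p v} \<in> parent_edges q" by (simp only: edges)
      then consider "p v = q v" | "v = q (p v)" by (auto simp: parent_edges_iff)
      then show ?case
      proof cases
        case 2
        then have "p (p v) = v" using IH by simp
        then show ?thesis
          using eventually_fixed_no_2_cycle[of p v] child eventually_fixed_step by metis
      qed
    qed
  next
    case False
    then show ?thesis
      using p q unfolding forest_parents_def parent_functions_def by (auto simp: PiE_iff extensional_def)
  qed
qed

text \<open>
  Orient the forest by letting the parent of a vertex be a neighbour that is closer to the root of
  its component. All edges arise in this way: an edge that does not would leave its two ends
  connected through their common root after its removal, contradicting
  \<open>acyclic_edge_is_bridge\<close>.
\<close>
lemma parents_of_forest:
  assumes FR: "(F, R) \<in> rooted_spanning_forests G"
  shows "\<exists>p\<in>forest_parents. parent_edges p = F \<and> parent_roots p = R"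
proof -
  define E where "E = {(x, y). {x, y} \<in> F}"
  have FG: "F \<subseteq> uedges G" and acyc: "ugraph_acyclic \<lparr>uverts = uverts G, uedges = F\<rparr>"
    and RV: "R \<subseteq> uverts G"
    and comp: "\<And>C. C \<in> uverts G // E\<^sup>* \<Longrightarrow> \<exists>!r. r \<in> C \<inter> R"
    using FR unfolding rooted_spanning_forests_def ugraph_components_def E_def by auto
  have root: "\<exists>!r. r \<in> E\<^sup>* `` {v} \<inter> R" if "v \<in> uverts G" for v
    using comp that by (simp only: quotientI)
  have symE: "sym E" unfolding E_def sym_def by (auto simp: insert_commute)
  \<comment> \<open>The distance to the set of roots.\<close>
  define d where "d v = (LEAST m. \<exists>r\<in>R. (v, r) \<in> E ^^ m)" for v
  have closer: "\<exists>w. (v, w) \<in> E \<and> d w < d v" if v: "v \<in> uverts G" "v \<notin> R" for v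
  proof -
    obtain r where "r \<in> R" "(v, r) \<in> E\<^sup>*" using root[OF v(1)] by auto
    then have ex: "\<exists>m. \<exists>r\<in>R. (v, r) \<in> E ^^ m" by (auto simp: rtrancl_power)
    then obtain r where r: "r \<in> R" "(v, r) \<in> E ^^ d v"
      using LeastI_ex[OF ex] unfolding d_def by blast
    have "d v \<noteq> 0" using r v by (metis relpow_0_E)
    then obtain m where m: "d v = Suc m" by (cases "d v") auto
    then obtain w where "(v, w) \<in> E" "(w, r) \<in> E ^^ m" using r relpow_Suc_E2 by metis
    moreover from this have "d w \<le> m" using r unfolding d_def by (intro Least_le) auto
    ultimately show ?thesis using m by auto
  qed
  define p where "p v = (if v \<in> uverts G then if v \<in> R then v else SOME w. (v, w) \<in> E \<and> d w < d v
     else undefined)" for v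
  have p_step: "(v, p v) \<in> E \<and> d (p v) < d v" if "v \<in> uverts G" "v \<notin> R" for v
    using someI_ex[OF closer[OF that]] that by (simp add: p_def)
  have p_root: "p v = v" if "v \<in> R" for v using that RV by (auto simp: p_def)
  have E_verts: "x \<noteq> y \<and> x \<in> uverts G \<and> y \<in> uverts G" if "(x, y) \<in> E" for x y
    using that FG edgeD by (auto simp: E_def)
  have fixed_iff: "p v = v \<longleftrightarrow> v \<in> R" if "v \<in> uverts G" for v
    using p_step[OF that] p_root by (metis less_irrefl)
  have "p v \<in> uverts G" if "v \<in> uverts G" for v
    using p_step[OF that] p_root[of v] E_verts that by metis
  moreover have "p v = v \<or> {v, p v} \<in> uedges G" if "v \<in> uverts G" for v
    using p_step[OF that] p_root[of v] FG by (auto simp: E_def)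
  ultimately have "p \<in> parent_functions"
    unfolding parent_functions_def by (auto simp: p_def extensional_def PiE_iff)
  moreover have "eventually_fixed p v" if "v \<in> uverts G" for v
    using that
  proof (induction "d v" arbitrary: v rule: less_induct)
    case less
    show ?case
    proof (cases "v \<in> R")
      case True
      then show ?thesis using p_root eventually_fixed_fixpoint by metis
    next
      case False
      then show ?thesis
        using less p_step[OF less.prems False] E_verts eventually_fixed_step by metis
    qed
  qed
  ultimately have p: "p \<in> forest_parents" unfolding forest_parents_def by auto
  have roots: "parent_roots p = R"
    using fixed_iff RV unfolding parent_roots_def by auto
  have sub: "parent_edges p \<subseteq> F"
    using p_step fixed_iff unfolding parent_edges_def by (auto simp: E_def)
  have "F \<subseteq> parent_edges p"
  proof
    fix e assume e: "e \<in> F"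
    then obtain u v where uv: "e = {u, v}" "u \<noteq> v" "u \<in> uverts G" "v \<in> uverts G"
      using FG edge_ends by blast
    show "e \<in> parent_edges p"
    proof (rule ccontr)
      assume no: "e \<notin> parent_edges p"
      define P where "P = {(x, y). {x, y} \<in> parent_edges p}"
      define E' where "E' = {(x, y). {x, y} \<in> F - {{u, v}}}"
      have PE': "P \<subseteq> E'" using sub no uv by (auto simp: P_def E'_def)
      have E'E: "E' \<subseteq> E" by (auto simp: E'_def E_def)
      have symE': "sym E'" unfolding E'_def sym_def by (auto simp: insert_commute)
      have up: "root_of p x \<in> R \<and> (x, root_of p x) \<in> E'\<^sup>*" if "x \<in> uverts G" for x
        using root_of_reachable[OF p that] roots rtrancl_mono[OF PE'] by (auto simp: P_def)
      have "(u, root_of p v) \<in> E\<^sup>*"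
        using e uv up[OF uv(4)] rtrancl_mono[OF E'E]
        by (auto simp: E_def intro: converse_rtrancl_into_rtrancl)
      moreover have "(u, root_of p u) \<in> E\<^sup>*" using up[OF uv(3)] rtrancl_mono[OF E'E] by auto
      ultimately have "root_of p u = root_of p v" using root[OF uv(3)] up uv by blast
      moreover have "(root_of p v, v) \<in> E'\<^sup>*"
        using up[OF uv(4)] sym_rtrancl[OF symE'] by (auto dest: symD)
      ultimately have "(u, v) \<in> E'\<^sup>*" using up[OF uv(3)] by (metis rtrancl_trans)
      then show False using acyclic_edge_is_bridge[OF acyc] e uv by (auto simp: E'_def)
    qed
  qed
  then show ?thesis using p roots sub by blast
qed

theorem card_rooted_spanning_forests: "card (rooted_spanning_forests G) = card forest_parents"
proof -
  have "bij_betw (\<lambda>p. (parent_edges p, parent_roots p)) forest_parents (rooted_spanning_forests G)"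
    unfolding bij_betw_def
  proof
    show "inj_on (\<lambda>p. (parent_edges p, parent_roots p)) forest_parents"
      using forest_determines_parents by (auto intro: inj_onI)
    show "(\<lambda>p. (parent_edges p, parent_roots p)) ` forest_parents = rooted_spanning_forests G"
      using forest_of_parents parents_of_forest by force
  qed
  then show ?thesis by (simp add: bij_betw_same_card)
qed

end

section \<open>The matrix forest theorem\<close>

text \<open>
  Row \<open>v\<close> is \<open>e\<^sub>v\<close> at a root and \<open>e\<^sub>v - e\<^sub>w\<close> at a vertex \<open>v\<close> with parent \<open>w\<close>.
\<close>
definition parent_matrix :: "nat \<Rightarrow> (nat \<Rightarrow> nat) \<Rightarrow> 'b::comm_ring_1 mat" where
  "parent_matrix n p = mat n n (\<lambda>(v, u). of_bool (u = v) - of_bool (p v \<noteq> v \<and> u = p v))"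

lemma parent_matrix_carrier [simp]: "parent_matrix n p \<in> carrier_mat n n"
  by (simp add: parent_matrix_def)

text \<open>
  A permutation that moves vertices only to their parents fixes the roots, hence by injectivity
  the children of roots, and so on up the forest.
\<close>
lemma permutes_along_parents_trivial:
  assumes \<sigma>: "\<sigma> permutes A" and along: "\<And>v. v \<in> A \<Longrightarrow> \<sigma> v = v \<or> \<sigma> v = p v"
    and fixed: "\<And>v. v \<in> A \<Longrightarrow> eventually_fixed p v"
  shows "\<sigma> = id"
proof
  fix v
  show "\<sigma> v = id v"
  proof (cases "v \<in> A")
    case True
    have "\<sigma> v = v" using fixed[OF True]
    proof (induction rule: eventually_fixed_induct)
      case (root v)
      then show ?case using along[of v] permutes_not_in[OF \<sigma>, of v] by metis
    next
      case (child v)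
      then have "\<sigma> v \<noteq> p v" using permutes_inj[OF \<sigma>] by (metis injD)
      then show ?case using along[of v] permutes_not_in[OF \<sigma>, of v] by metis
    qed
    then show ?thesis by simp
  next
    case False
    then show ?thesis using permutes_not_in[OF \<sigma>] by simp
  qed
qed

text \<open>
  In the Leibniz formula a permutation contributes only if it moves vertices to their parents,
  so only the identity does.
\<close>
lemma det_parent_matrix_forest:
  assumes fixed: "\<And>v. v < n \<Longrightarrow> eventually_fixed p v"
  shows "det (parent_matrix n p :: 'b::comm_ring_1 mat) = 1"
proof -
  let ?M = "parent_matrix n p :: 'b mat"
  let ?t = "\<lambda>\<sigma>. signof \<sigma> * (\<Prod>i = 0..<n. ?M $$ (i, \<sigma> i))"
  let ?S = "{\<sigma>. \<sigma> permutes {0..<n}}"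
  have zero: "?t \<sigma> = 0" if "\<sigma> \<in> ?S - {id}" for \<sigma>
  proof -
    have \<sigma>: "\<sigma> permutes {0..<n}" "\<sigma> \<noteq> id" using that by auto
    then obtain v where v: "v < n" "\<sigma> v \<noteq> v" "\<sigma> v \<noteq> p v"
      using permutes_along_parents_trivial[OF \<sigma>(1), of p] fixed by auto
    then have "\<sigma> v < n" using permutes_in_image[OF \<sigma>(1), of v] by simp
    then have "?M $$ (v, \<sigma> v) = 0" using v by (simp add: parent_matrix_def)
    then have "(\<Prod>i = 0..<n. ?M $$ (i, \<sigma> i)) = 0" using v by (intro prod_zero) auto
    then show ?thesis by simp
  qed
  have "det ?M = (\<Sum>\<sigma>\<in>?S. ?t \<sigma>)" by (rule det_def') simp
  also have "\<dots> = ?t id + (\<Sum>\<sigma>\<in>?S - {id}. ?t \<sigma>)"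
    by (rule sum.remove) (auto simp: finite_permutations permutes_id)
  also have "(\<Sum>\<sigma>\<in>?S - {id}. ?t \<sigma>) = 0" using zero by (rule sum.neutral[rule_format])
  also have "?t id = 1" by (auto simp: parent_matrix_def intro!: prod.neutral)
  finally show ?thesis by simp
qed

text \<open>
  The indicator function of the vertices from which no root is reached takes the same value at a
  vertex and at its parent and vanishes at the roots, so it lies in the kernel.
\<close>
lemma det_parent_matrix_cyclic:
  assumes closed: "\<And>v. v < n \<Longrightarrow> p v < n" and w: "w < n" "\<not> eventually_fixed p w"
  shows "det (parent_matrix n p :: 'b::idom mat) = 0"
proof -
  let ?M = "parent_matrix n p :: 'b mat"
  let ?x = "vec n (\<lambda>u. of_bool (\<not> eventually_fixed p u)) :: 'b vec"
  have "?x \<noteq> 0\<^sub>v n"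
  proof
    assume "?x = 0\<^sub>v n"
    then have "vec_index ?x w = vec_index (0\<^sub>v n) w" by simp
    then show False using w by simp
  qed
  moreover have "?M *\<^sub>v ?x = 0\<^sub>v n"
  proof (rule eq_vecI)
    fix v assume "v < dim_vec (0\<^sub>v n)"
    then have v: "v < n" by simp
    have "vec_index (?M *\<^sub>v ?x) v = (\<Sum>u = 0..<n. ?M $$ (v, u) * vec_index ?x u)"
      using v by (simp add: parent_matrix_def scalar_prod_def)
    also have "\<dots> = (\<Sum>u = 0..<n. of_bool (u = v) * vec_index ?x u) - (\<Sum>u = 0..<n. of_bool (u = p v) * (of_bool (p v \<noteq> v) * vec_index ?x u))"
      using v unfolding sum_subtractf[symmetric]
      by (intro sum.cong) (auto simp: parent_matrix_def algebra_simps)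
    also have "\<dots> = vec_index ?x v - of_bool (p v \<noteq> v) * vec_index ?x (p v)"
      using v closed[OF v] by (simp add: of_bool_def if_distrib[of "\<lambda>t. t * _"] cong: if_cong)
    also have "\<dots> = 0"
      using v closed[OF v] eventually_fixed_step[of p v] eventually_fixed_fixpoint[of p v] by auto
    finally show "vec_index (?M *\<^sub>v ?x) v = vec_index (0\<^sub>v n) v" using v by simp
  qed (simp add: parent_matrix_def)
  ultimately show ?thesis
    unfolding det_0_iff_vec_prod_zero[OF parent_matrix_carrier] by (intro exI[of _ ?x]) simp
qed

definition neighbours :: "'a ugraph \<Rightarrow> 'a \<Rightarrow> 'a set" where
  "neighbours G v = {w. {v, w} \<in> uedges G}"

text \<open>
  The sum \<open>I + L\<close> of the identity and the Laplacian. Adding the identity to \<open>L\<close> amounts to adding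
  a vertex joined to all others, whose spanning trees are the rooted spanning forests.
\<close>
definition one_plus_laplacian :: "nat \<Rightarrow> nat ugraph \<Rightarrow> 'b::comm_ring_1 mat" where
  "one_plus_laplacian n G = mat n n (\<lambda>(v, u).
     if u = v then 1 + of_nat (card (neighbours G v)) else - of_bool (u \<in> neighbours G v))"

lemma one_plus_laplacian_carrier [simp]: "one_plus_laplacian n G \<in> carrier_mat n n"
  by (simp add: one_plus_laplacian_def)

context loopless_graph
begin

lemma not_own_neighbour: "v \<notin> neighbours G v"
  using edgeD[of v v] by (auto simp: neighbours_def)

lemma neighbours_subset: "neighbours G v \<subseteq> uverts G"
  using edgeD by (auto simp: neighbours_def)

lemma parent_functions_PiE:
  "parent_functions = (\<Pi>\<^sub>E v\<in>uverts G. insert v (neighbours G v))"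
proof -
  have "w \<in> insert v (neighbours G v) \<longleftrightarrow> w \<in> uverts G \<and> (w = v \<or> {v, w} \<in> uedges G)"
    if "v \<in> uverts G" for v w
    using that neighbours_subset[of v] by (auto simp: neighbours_def)
  then show ?thesis
    unfolding parent_functions_def PiE_iff set_eq_iff mem_Collect_eq by blast
qed

end

text \<open>
  Row \<open>v\<close> of \<open>I + L\<close> is \<open>e\<^sub>v\<close> plus the sum of \<open>e\<^sub>v - e\<^sub>w\<close> over the neighbours \<open>w\<close>, that is, the sum of
  the possible rows of a parent matrix. Multilinearity turns the determinant into the sum of the
  determinants of all parent matrices, which are 1 for forests and 0 otherwise.
\<close>
theorem matrix_forest_theorem:
  fixes G :: "nat ugraph"
  assumes "loopless_graph G" and V: "uverts G = {0..<n}"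
  shows "det (one_plus_laplacian n G :: 'b::idom mat) = of_nat (card (rooted_spanning_forests G))"
proof -
  interpret loopless_graph G by fact
  let ?B = "\<lambda>v. insert v (neighbours G v)"
  let ?S = "{\<sigma>. \<sigma> permutes {0..<n}}"
  define e :: "nat \<Rightarrow> nat \<Rightarrow> nat \<Rightarrow> 'b"
    where "e v w u = of_bool (u = v) - of_bool (w \<noteq> v \<and> u = w)" for v w u
  have finN: "finite (neighbours G v)" for v
    using neighbours_subset V finite_subset by (metis finite_atLeastLessThan)
  have entry: "one_plus_laplacian n G $$ (v, u) = (\<Sum>w\<in>?B v. e v w u)" if "v < n" "u < n" for v u
  proof (cases "u = v")
    case True
    have "(\<Sum>w\<in>?B v. e v w v) = (\<Sum>w\<in>?B v. 1)"
      by (intro sum.cong) (auto simp: e_def)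
    then show ?thesis
      using that True finN not_own_neighbour by (simp add: one_plus_laplacian_def)
  next
    case False
    then have "(\<Sum>w\<in>?B v. e v w u) = (\<Sum>w\<in>?B v. if u = w then - 1 else 0)"
      by (intro sum.cong) (auto simp: e_def)
    then show ?thesis
      using that False finN by (simp add: one_plus_laplacian_def sum.delta)
  qed
  have "det (one_plus_laplacian n G :: 'b mat) =
      (\<Sum>\<sigma>\<in>?S. signof \<sigma> * (\<Prod>v = 0..<n. \<Sum>w\<in>?B v. e v w (\<sigma> v)))"
    unfolding det_def'[OF one_plus_laplacian_carrier]
    by (intro sum.cong refl arg_cong2[of _ _ _ _ "(*)"] prod.cong entry)
      (auto dest: permutes_in_image)
  also have "\<dots> = (\<Sum>\<sigma>\<in>?S. \<Sum>p\<in>parent_functions. signof \<sigma> * (\<Prod>v = 0..<n. e v (p v) (\<sigma> v)))"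
    using finN by (subst prod_sum_PiE) (auto simp: parent_functions_PiE V sum_distrib_left)
  also have "\<dots> = (\<Sum>p\<in>parent_functions. \<Sum>\<sigma>\<in>?S. signof \<sigma> * (\<Prod>v = 0..<n. e v (p v) (\<sigma> v)))"
    by (rule sum.swap)
  also have "\<dots> = (\<Sum>p\<in>parent_functions. det (parent_matrix n p))"
    unfolding det_def'[OF parent_matrix_carrier]
    by (intro sum.cong refl arg_cong2[of _ _ _ _ "(*)"] prod.cong)
      (auto simp: e_def parent_matrix_def permutes_in_image)
  also have "\<dots> = (\<Sum>p\<in>parent_functions. of_bool (p \<in> forest_parents))"
  proof (intro sum.cong refl)
    fix p assume p: "p \<in> parent_functions"
    then have closed: "p v < n" if "v < n" for v
      using that V by (auto simp: parent_functions_def PiE_iff)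
    show "det (parent_matrix n p) = (of_bool (p \<in> forest_parents) :: 'b)"
    proof (cases "p \<in> forest_parents")
      case True
      then have "eventually_fixed p v" if "v < n" for v
        using that V by (simp add: forest_parents_def)
      from det_parent_matrix_forest[OF this] True show ?thesis by simp
    next
      case False
      then obtain w where "w < n" "\<not> eventually_fixed p w"
        using p V by (auto simp: forest_parents_def)
      from det_parent_matrix_cyclic[OF closed this] False show ?thesis by simp
    qed
  qed
  also have "\<dots> = of_nat (card forest_parents)"
  proof -
    have "finite parent_functions"
      using finN V by (auto simp: parent_functions_PiE intro!: finite_PiE)
    moreover have "parent_functions \<inter> {p. p \<in> forest_parents} = forest_parents"
      by (auto simp: forest_parents_def)
    ultimately show ?thesis by (simp add: sum.If_cases of_bool_def)
  qed
  finally show ?thesis by (simp only: card_rooted_spanning_forests)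
qed

section \<open>The Laplacian spectrum of a circulant graph\<close>
lemma root_of_unity_powers_sum:
  fixes w :: complex
  assumes "w ^ n = 1"
  shows "(\<Sum>u = 0..<n. w ^ u) = (if w = 1 then of_nat n else 0)"
  using assms by (simp add: atLeast0LessThan geometric_sum)

text \<open>
  The hypothesis says that the vectors \<open>(1, z\<^sub>j, z\<^sub>j\<^sup>2, \<dots>)\<close> are eigenvectors. They form a basis:
  multiplying the matrix \<open>X\<close> with these columns by the matrix \<open>Y\<close> of the inverse powers gives
  \<open>n\<close> times the identity, by orthogonality of the characters of \<open>\<int>/n\<close>.
\<close>
lemma det_fourier_eigenbasis:
  fixes A :: "complex mat" and z \<mu> :: "nat \<Rightarrow> complex"
  assumes A: "A \<in> carrier_mat n n"
    and z: "\<And>j. j < n \<Longrightarrow> z j ^ n = 1" "inj_on z {0..<n}"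
    and eigen: "\<And>v j. v < n \<Longrightarrow> j < n \<Longrightarrow> (\<Sum>u = 0..<n. A $$ (v, u) * z j ^ u) = \<mu> j * z j ^ v"
  shows "det A = (\<Prod>j = 0..<n. \<mu> j)"
proof (cases "n = 0")
  case True
  then show ?thesis using A by (simp add: det_def)
next
  case False
  define X where "X = mat n n (\<lambda>(u, j). z j ^ u)"
  define Y where "Y = mat n n (\<lambda>(i, u). inverse (z i) ^ u)"
  define D where "D = mat n n (\<lambda>(i, j). if i = j then \<mu> j else 0)"
  have car: "X \<in> carrier_mat n n" "Y \<in> carrier_mat n n" "D \<in> carrier_mat n n"
    by (auto simp: X_def Y_def D_def)
  have nz: "z j \<noteq> 0" if "j < n" for j using z(1)[OF that] False by (metis power_eq_0_iff zero_neq_one not_gr_zero power_0_left)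
  have "Y * X = of_nat n \<cdot>\<^sub>m 1\<^sub>m n"
  proof (rule eq_matI)
    fix i j assume "i < dim_row (of_nat n \<cdot>\<^sub>m 1\<^sub>m n :: complex mat)" "j < dim_col (of_nat n \<cdot>\<^sub>m 1\<^sub>m n :: complex mat)"
    then have ij: "i < n" "j < n" by auto
    have "(Y * X) $$ (i, j) = (\<Sum>u = 0..<n. inverse (z i) ^ u * z j ^ u)"
      using ij by (simp add: X_def Y_def scalar_prod_def)
    also have "\<dots> = (\<Sum>u = 0..<n. (z j / z i) ^ u)"
      by (intro sum.cong refl) (simp add: power_mult_distrib divide_inverse mult.commute)
    also have "\<dots> = (if z j / z i = 1 then of_nat n else 0)"
      using z(1) ij by (intro root_of_unity_powers_sum) (simp add: power_divide)
    also have "z j / z i = 1 \<longleftrightarrow> i = j"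
      using nz[OF ij(1)] z(2) ij by (auto dest: inj_onD)
    finally show "(Y * X) $$ (i, j) = (of_nat n \<cdot>\<^sub>m 1\<^sub>m n) $$ (i, j)"
      using ij by simp
  qed (auto simp: X_def Y_def)
  then have "det Y * det X = of_nat n ^ n"
    using det_mult[OF car(2,1)] by simp
  then have detX: "det X \<noteq> 0" using False by auto
  have "A * X = X * D"
  proof (rule eq_matI)
    fix v j assume "v < dim_row (X * D)" "j < dim_col (X * D)"
    then have vj: "v < n" "j < n" by (auto simp: X_def D_def)
    have "(A * X) $$ (v, j) = (\<Sum>u = 0..<n. A $$ (v, u) * z j ^ u)"
      using vj A by (simp add: X_def scalar_prod_def)
    also have "\<dots> = \<mu> j * z j ^ v" using eigen vj .
    also have "\<dots> = (\<Sum>i = 0..<n. if i = j then z i ^ v * \<mu> j else 0)"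
      using vj by simp
    also have "\<dots> = (X * D) $$ (v, j)"
      using vj by (simp add: X_def D_def scalar_prod_def if_distrib[of "\<lambda>t. _ * t"] cong: if_cong)
    finally show "(A * X) $$ (v, j) = (X * D) $$ (v, j)" .
  qed (use A in \<open>auto simp: X_def D_def\<close>)
  then have "det A * det X = det X * det D"
    using det_mult[OF A car(1)] det_mult[OF car(1,3)] by metis
  then have "det X * det A = det X * det D" by (simp only: mult.commute)
  then have "det A = det D" using detX by simp
  also have "\<dots> = (\<Prod>j = 0..<n. D $$ (j, j))"
    using det_upper_triangular[OF _ car(3)] car(3)
    by (auto simp: D_def upper_triangular_def prod_list_diag_prod)
  also have "\<dots> = (\<Prod>j = 0..<n. \<mu> j)" by (simp add: D_def)
  finally show ?thesis .
qed

text \<open>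
  Jumps below \<open>n/2\<close> lead from a vertex to pairwise different vertices, so the graph is regular of
  degree \<open>2 * card S\<close>.
\<close>
locale circulant =
  fixes n :: nat and S :: "nat set"
  assumes jump_pos: "a \<in> S \<Longrightarrow> 0 < a" and jump_less: "a \<in> S \<Longrightarrow> 2 * a < n"
begin

definition shift :: "nat \<Rightarrow> int \<Rightarrow> nat" where
  "shift v m = nat ((int v + m) mod int n)"

lemma int_shift: "0 < n \<Longrightarrow> int (shift v m) = (int v + m) mod int n"
  by (simp add: shift_def)

lemma shift_less: "0 < n \<Longrightarrow> shift v m < n"
  by (simp add: shift_def nat_less_iff)

lemma shift_eq_iff:
  assumes "0 < n" "\<bar>m - m'\<bar> < int n"
  shows "shift v m = shift v m' \<longleftrightarrow> m = m'"
proof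
  assume "shift v m = shift v m'"
  then have "(int v + m) mod int n = (int v + m') mod int n"
    using int_shift[OF assms(1)] by metis
  then have "int n dvd m - m'"
    by (simp add: mod_eq_dvd_iff)
  then show "m = m'" using assms(2) zdvd_imp_le[of "int n" "\<bar>m - m'\<bar>"] by (cases "m = m'") auto
qed simp

lemma shift_shift: "0 < n \<Longrightarrow> v < n \<Longrightarrow> shift (shift v m) (- m) = v"
  unfolding shift_def[of "shift v m"] int_shift by (simp add: mod_simps)

lemma finite_jumps: "finite S"
  by (rule finite_subset[of _ "{..<n}"]) (use jump_less in force)+

text \<open>
  Edges are unordered pairs, but adjacency by jumps is already symmetric because a jump can be
  undone by the opposite one.
\<close>
lemma circulant_edge_iff:
  "{u, v} \<in> uedges (circulant_graph n S) \<longleftrightarrow>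
     u < n \<and> (\<exists>a\<in>S. v = shift u (int a) \<or> v = shift u (- int a))"
proof -
  define R where "R u v \<longleftrightarrow> u < n \<and> (\<exists>a\<in>S. v = shift u (int a) \<or> v = shift u (- int a))" for u v
  have R: "R u v \<longleftrightarrow> u < n \<and> (\<exists>a\<in>S. int v = (int u + int a) mod int n \<or> int v = (int u - int a) mod int n)" for u v
  proof (cases "u < n")
    case True
    then have "0 < n" by simp
    then have "v = shift u m \<longleftrightarrow> int v = (int u + m) mod int n" for m
      using int_shift by (metis of_nat_eq_iff)
    then show ?thesis by (simp add: R_def)
  qed (simp add: R_def)
  have sym: "R v u" if uv: "R u v" for u v
  proof -
    obtain a where a: "u < n" "a \<in> S" "v = shift u (int a) \<or> v = shift u (- int a)"
      using uv by (auto simp: R_def)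
    then have "u = shift v (- int a) \<or> u = shift v (int a)"
      using shift_shift[of u "int a"] shift_shift[of u "- int a"] by auto
    moreover have "v < n" using a shift_less by auto
    ultimately show ?thesis using a by (auto simp: R_def)
  qed
  have "{u, v} \<in> uedges (circulant_graph n S) \<longleftrightarrow> R u v \<or> R v u"
    unfolding circulant_graph_def R by (auto simp: doubleton_eq_iff)
  then have "{u, v} \<in> uedges (circulant_graph n S) \<longleftrightarrow> R u v" using sym by blast
  then show ?thesis by (simp add: R_def)
qed

lemma circulant_verts: "uverts (circulant_graph n S) = {0..<n}"
  by (simp add: circulant_graph_def)

lemma loopless_circulant: "loopless_graph (circulant_graph n S)"
proof
  fix e assume e: "e \<in> uedges (circulant_graph n S)"
  then obtain u v where uv: "e = {u, v}" unfolding circulant_graph_def by auto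
  then obtain a where a: "u < n" "a \<in> S" "v = shift u (int a) \<or> v = shift u (- int a)"
    using e circulant_edge_iff by auto
  have "shift u (int a) \<noteq> shift u 0" "shift u (- int a) \<noteq> shift u 0"
    using a(1) jump_pos[OF a(2)] jump_less[OF a(2)] by (simp_all add: shift_eq_iff)
  moreover have "shift u 0 = u" using a(1) by (simp add: shift_def)
  ultimately have "u \<noteq> v" using a(3) by metis
  moreover have "v < n" using a shift_less by auto
  ultimately show "\<exists>u v. e = {u, v} \<and> u \<noteq> v \<and> u \<in> uverts (circulant_graph n S) \<and> v \<in> uverts (circulant_graph n S)"
    using uv a by (auto simp: circulant_verts)
qed

lemma sum_neighbours_circulant:
  assumes v: "v < n"
  shows "(\<Sum>w\<in>neighbours (circulant_graph n S) v. g w) =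
    (\<Sum>a\<in>S. g (shift v (int a)) + g (shift v (- int a)))"
proof -
  have n: "0 < n" using v by simp
  have "neighbours (circulant_graph n S) v =
      (\<lambda>a. shift v (int a)) ` S \<union> (\<lambda>a. shift v (- int a)) ` S"
    using v by (auto simp: neighbours_def circulant_edge_iff)
  moreover have "shift v (int a) \<noteq> shift v (- int b)" if "a \<in> S" "b \<in> S" for a b
    using jump_pos[OF that(1)] jump_less[OF that(1)] jump_less[OF that(2)] n
    by (subst shift_eq_iff) auto
  then have "(\<lambda>a. shift v (int a)) ` S \<inter> (\<lambda>a. shift v (- int a)) ` S = {}" by auto
  moreover have "inj_on (\<lambda>a. shift v (int a)) S" "inj_on (\<lambda>a. shift v (- int a)) S"
  proof -
    have close: "\<bar>int a - int b\<bar> < int n" "\<bar>- int a - - int b\<bar> < int n" if "a \<in> S" "b \<in> S" for a b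
      using jump_less[OF that(1)] jump_less[OF that(2)] by auto
    show "inj_on (\<lambda>a. shift v (int a)) S" "inj_on (\<lambda>a. shift v (- int a)) S"
      by (auto intro!: inj_onI simp: shift_eq_iff[OF n close(1)] shift_eq_iff[OF n close(2)])
  qed
  ultimately show ?thesis
    by (simp add: sum.union_disjoint finite_jumps sum.reindex sum.distrib)
qed

lemma root_of_unity_power_shift:
  fixes z :: complex
  assumes z: "z ^ n = 1" and n: "0 < n"
  shows "z ^ shift v m = z ^ v * z powi m"
proof -
  have nz: "z \<noteq> 0" using z n by (auto simp: power_0_left)
  let ?q = "(int v + m) div int n"
  have "z ^ v * z powi m = z powi (int v + m)"
    using nz by (simp add: power_int_add)
  also have "int v + m = int n * ?q + int (shift v m)"
    by (simp add: int_shift[OF n])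
  also have "z powi \<dots> = (z powi int n) powi ?q * z ^ shift v m"
    using nz by (simp add: power_int_add power_int_mult)
  also have "\<dots> = z ^ shift v m" using z by simp
  finally show ?thesis by simp
qed

text \<open>
  For an \<open>n\<close>-th root of unity \<open>z\<close> the powers \<open>z ^ u\<close> depend only on \<open>u\<close> modulo \<open>n\<close>, so a jump by
  \<open>a\<close> multiplies the vector by \<open>z powi a\<close>.
\<close>
lemma circulant_eigenvector:
  fixes z :: complex
  assumes z: "z ^ n = 1" and v: "v < n"
  shows "(\<Sum>u = 0..<n. one_plus_laplacian n (circulant_graph n S) $$ (v, u) * z ^ u) =
    (1 + (\<Sum>a\<in>S. 2 - (z powi int a + z powi (- int a)))) * z ^ v"
proof -
  interpret loopless_graph "circulant_graph n S" by (rule loopless_circulant)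
  let ?N = "neighbours (circulant_graph n S) v"
  have N: "?N \<subseteq> {0..<n}" "v \<notin> ?N"
    using neighbours_subset not_own_neighbour by (auto simp: circulant_verts)
  have "(of_nat (card ?N) :: complex) = (\<Sum>w\<in>?N. 1)" by simp
  also have "\<dots> = (\<Sum>a\<in>S. 1 + 1)" by (rule sum_neighbours_circulant[OF v])
  also have "\<dots> = (\<Sum>a\<in>S. 2)" by simp
  finally have card: "(of_nat (card ?N) :: complex) = (\<Sum>a\<in>S. 2)" .
  have "(\<Sum>u = 0..<n. one_plus_laplacian n (circulant_graph n S) $$ (v, u) * z ^ u) =
      (\<Sum>u = 0..<n. (if u = v then (1 + of_nat (card ?N)) * z ^ u else 0) - (if u \<in> ?N then z ^ u else 0))"
    using v N by (intro sum.cong) (auto simp: one_plus_laplacian_def)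
  also have "\<dots> = (1 + of_nat (card ?N)) * z ^ v - (\<Sum>w\<in>?N. z ^ w)"
    using v N by (simp add: sum_subtractf sum.inter_restrict[symmetric] Int_absorb1)
  also have "(\<Sum>w\<in>?N. z ^ w) = (\<Sum>a\<in>S. z powi int a + z powi (- int a)) * z ^ v"
    using v z by (simp add: sum_neighbours_circulant root_of_unity_power_shift sum_distrib_left
        algebra_simps del: power_int_of_nat power_int_minus)
  finally show ?thesis by (simp add: card sum_subtractf algebra_simps)
qed

theorem card_forests_circulant:
  "of_nat (card (rooted_spanning_forests (circulant_graph n S))) =
    (\<Prod>j = 0..<n. 1 + (\<Sum>a\<in>S. 2 - (exp (2 * of_real pi * \<i> * of_nat j / of_nat n) powi int a
        + exp (2 * of_real pi * \<i> * of_nat j / of_nat n) powi (- int a))))"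
proof (cases "n = 0")
  case True
  then show ?thesis
    using matrix_forest_theorem[OF loopless_circulant circulant_verts, where 'b = complex]
    by (simp add: det_def one_plus_laplacian_def)
next
  case False
  show ?thesis
    unfolding matrix_forest_theorem[OF loopless_circulant circulant_verts, symmetric]
  proof (rule det_fourier_eigenbasis)
    show "inj_on (\<lambda>j. exp (2 * of_real pi * \<i> * of_nat j / of_nat n)) {0..<n}"
      using False by (auto intro!: inj_onI simp: complex_root_unity_eq cong_def)
  next
    fix v j assume "v < n" "j < n"
    show "(\<Sum>u = 0..<n. one_plus_laplacian n (circulant_graph n S) $$ (v, u) *
        exp (2 * of_real pi * \<i> * of_nat j / of_nat n) ^ u) =
      (1 + (\<Sum>a\<in>S. 2 - (exp (2 * of_real pi * \<i> * of_nat j / of_nat n) powi int a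
        + exp (2 * of_real pi * \<i> * of_nat j / of_nat n) powi (- int a)))) *
        exp (2 * of_real pi * \<i> * of_nat j / of_nat n) ^ v"
      using False \<open>v < n\<close> by (intro circulant_eigenvector complex_root_unity)
  qed (use False in \<open>auto intro: complex_root_unity\<close>)
qed

end

section \<open>Riemann sums of periodic functions\<close>

text \<open>
  As a function of its right end point \<open>x\<close>, the error of the trapezoidal rule on \<open>{a..x}\<close> has
  derivative \<open>(g x - g a - (x - a) * g' x) / 2\<close>, a Taylor remainder of second order, and it vanishes
  at \<open>a\<close>. The mean value theorem then gives the cubic bound.
\<close>
lemma trapezoid_panel_error:
  fixes g g' g'' :: "real \<Rightarrow> real"
  assumes g: "\<And>x. (g has_real_derivative g' x) (at x)"
    and g': "\<And>x. (g' has_real_derivative g'' x) (at x)"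
    and M: "\<And>x. \<bar>g'' x\<bar> \<le> M" and ab: "a \<le> b"
  shows "\<bar>integral {a..b} g - (b - a) * (g a + g b) / 2\<bar> \<le> M * (b - a) ^ 3"
proof -
  have M0: "0 \<le> M" using M[of 0] by linarith
  have mvt': "\<bar>g' x - g' y\<bar> \<le> M * \<bar>x - y\<bar>" for x y
    using field_differentiable_bound[of UNIV g' g'' M x y] g' M by auto
  have linear: "\<bar>g x - g a - (x - a) * g' x\<bar> \<le> M * (b - a) * (b - a)" if x: "x \<in> {a..b}" for x
  proof -
    define \<phi> where "\<phi> t = g t - t * g' x" for t
    have "norm (\<phi> x - \<phi> a) \<le> M * (b - a) * norm (x - a)"
    proof (rule field_differentiable_bound[of "{a..b}" \<phi> "\<lambda>t. g' t - g' x"])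
      fix t assume t: "t \<in> {a..b}"
      show "(\<phi> has_real_derivative g' t - g' x) (at t within {a..b})"
        unfolding \<phi>_def by (auto intro!: derivative_eq_intros DERIV_subset[OF g])
      have "M * \<bar>t - x\<bar> \<le> M * (b - a)" using t x M0 by (intro mult_left_mono) auto
      then show "norm (g' t - g' x) \<le> M * (b - a)" using mvt'[of t x] by simp
    qed (use x in auto)
    also have "\<dots> \<le> M * (b - a) * (b - a)" using x ab M0 by (intro mult_left_mono) auto
    finally show ?thesis by (simp add: \<phi>_def algebra_simps)
  qed
  define F where "F x = integral {a..x} g - (x - a) * (g a + g x) / 2" for x
  have cont: "continuous_on {a..b} g"
    using g by (intro DERIV_continuous_on) (blast intro: DERIV_subset)
  have "norm (F b - F a) \<le> M * (b - a) * (b - a) * norm (b - a)"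
  proof (rule field_differentiable_bound[of "{a..b}" F "\<lambda>x. (g x - g a - (x - a) * g' x) / 2"])
    fix x assume x: "x \<in> {a..b}"
    show "(F has_real_derivative (g x - g a - (x - a) * g' x) / 2) (at x within {a..b})"
      unfolding F_def
      by (auto intro!: derivative_eq_intros integral_has_real_derivative[OF cont x] DERIV_subset[OF g])
        (simp add: field_simps)
    show "norm ((g x - g a - (x - a) * g' x) / 2) \<le> M * (b - a) * (b - a)"
      using linear[OF x] by simp
  qed (use ab in auto)
  then show ?thesis using ab by (simp add: F_def power3_eq_cube mult.assoc)
qed

lemma trapezoid_sum_error:
  fixes g g' g'' :: "real \<Rightarrow> real"
  assumes g: "\<And>x. (g has_real_derivative g' x) (at x)"
    and g': "\<And>x. (g' has_real_derivative g'' x) (at x)"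
    and M: "\<And>x. \<bar>g'' x\<bar> \<le> M" and h: "0 \<le> h"
  shows "\<bar>integral {0..real m * h} g - h * ((\<Sum>j<m. g (real j * h)) + (g (real m * h) - g 0) / 2)\<bar>
      \<le> real m * (M * h ^ 3)"
proof (induction m)
  case (Suc m)
  let ?a = "real m * h" and ?b = "real (Suc m) * h"
  have ab: "0 \<le> ?a" "?a \<le> ?b" "?b - ?a = h" using h by (auto simp: algebra_simps)
  have "continuous_on {0..?b} g"
    using g by (intro DERIV_continuous_on) (blast intro: DERIV_subset)
  then have split: "integral {0..?a} g + integral {?a..?b} g = integral {0..?b} g"
    using ab by (intro Henstock_Kurzweil_Integration.integral_combine integrable_continuous_real) auto
  have panel: "\<bar>integral {?a..?b} g - h * (g ?a + g ?b) / 2\<bar> \<le> M * h ^ 3"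
    using trapezoid_panel_error[OF g g' M ab(2)] unfolding ab(3) .
  have "h * ((\<Sum>j<Suc m. g (real j * h)) + (g ?b - g 0) / 2) =
      h * ((\<Sum>j<m. g (real j * h)) + (g ?a - g 0) / 2) + h * (g ?a + g ?b) / 2"
    by (simp add: field_simps)
  then have "integral {0..?b} g - h * ((\<Sum>j<Suc m. g (real j * h)) + (g ?b - g 0) / 2) =
      (integral {0..?a} g - h * ((\<Sum>j<m. g (real j * h)) + (g ?a - g 0) / 2)) +
      (integral {?a..?b} g - h * (g ?a + g ?b) / 2)"
    using split by linarith
  also have "\<bar>\<dots>\<bar> \<le> real m * (M * h ^ 3) + M * h ^ 3"
    using Suc.IH panel by (rule order_trans[OF abs_triangle_ineq add_mono])
  also have "\<dots> = real (Suc m) * (M * h ^ 3)" by (simp add: algebra_simps)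
  finally show ?case .
qed simp

text \<open>
  A left Riemann sum has error of order \<open>1 / n\<close> in general, which would not suffice. For a periodic
  function the sum equals the trapezoidal sum, and the error improves to order \<open>1 / n\<^sup>2\<close>, which
  tends to 0 even after multiplication by \<open>n\<close>.
\<close>
theorem periodic_riemann_sum_error_tendsto_0:
  fixes g g' g'' :: "real \<Rightarrow> real"
  assumes g: "\<And>x. (g has_real_derivative g' x) (at x)"
    and g': "\<And>x. (g' has_real_derivative g'' x) (at x)"
    and M: "\<And>x. \<bar>g'' x\<bar> \<le> M" and periodic: "g 1 = g 0"
  shows "(\<lambda>n. (\<Sum>j<n. g (real j / real n)) - real n * integral {0..1} g) \<longlonglongrightarrow> 0"
proof (rule Lim_null_comparison)
  show "(\<lambda>n. M / real n) \<longlonglongrightarrow> 0" by (rule lim_const_over_n)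
  show "\<forall>\<^sub>F n in sequentially. norm ((\<Sum>j<n. g (real j / real n)) - real n * integral {0..1} g) \<le> M / real n"
  proof (intro eventually_mono[OF eventually_gt_at_top[of 0]])
    fix n :: nat assume n: "0 < n"
    let ?d = "integral {0..1} g - (1 / real n) * (\<Sum>j<n. g (real j / real n))"
    have "\<bar>?d\<bar> \<le> real n * (M * (1 / real n) ^ 3)"
      using trapezoid_sum_error[OF g g' M, of "1 / real n" n] n periodic by simp
    then have "real n * \<bar>?d\<bar> \<le> real n * (real n * (M * (1 / real n) ^ 3))"
      by (intro mult_left_mono) auto
    also have "\<dots> = M / real n" using n by (simp add: power3_eq_cube field_simps)
    also have "real n * \<bar>?d\<bar> = \<bar>real n * ?d\<bar>" by (simp add: abs_mult)
    also have "real n * ?d = - ((\<Sum>j<n. g (real j / real n)) - real n * integral {0..1} g)"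
      using n by (simp add: algebra_simps)
    finally show "norm ((\<Sum>j<n. g (real j / real n)) - real n * integral {0..1} g) \<le> M / real n"
      by simp
  qed
qed

section \<open>The Laurent polynomial on the unit circle\<close>

text \<open>
  The value of the Laurent polynomial at \<open>exp (2 \<pi> \<i> t)\<close>, which is real.
\<close>
definition circulant_symbol :: "nat set \<Rightarrow> real \<Rightarrow> real" where
  "circulant_symbol S t = 1 + (\<Sum>a\<in>S. 2 - 2 * cos (2 * pi * real a * t))"

lemma circulant_symbol_ge_1: "1 \<le> circulant_symbol S t"
  by (simp add: circulant_symbol_def sum_nonneg)

lemma powi_unit_circle_cos:
  "exp (2 * of_real pi * \<i> * of_real t) powi int a + exp (2 * of_real pi * \<i> * of_real t) powi (- int a)
    = complex_of_real (2 * cos (2 * pi * real a * t))"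
proof -
  have "complex_of_real (cos (2 * pi * real a * t)) = cos (of_real (2 * pi * real a * t))"
    by (rule cos_of_real[symmetric])
  then show ?thesis
    unfolding cos_exp_eq exp_power_int by (simp add: algebra_simps)
qed

lemma circulant_symbol_complex:
  "1 + (\<Sum>a\<in>S. 2 - (exp (2 * of_real pi * \<i> * of_real t) powi int a
      + exp (2 * of_real pi * \<i> * of_real t) powi (- int a))) = complex_of_real (circulant_symbol S t)"
  unfolding powi_unit_circle_cos circulant_symbol_def by simp

lemma circulant_laurent_unit_circle:
  assumes "inj_on s {1..k}"
  shows "circulant_laurent k s (exp (2 * of_real pi * \<i> * of_real t)) =
    complex_of_real (circulant_symbol (s ` {1..k}) t)"
  unfolding circulant_laurent_def powi_unit_circle_cos circulant_symbol_def
  using assms by (simp add: sum.reindex card_image sum_subtractf)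

text \<open>
  The derivatives of the symbol are trigonometric polynomials, hence bounded, and the symbol is
  bounded away from 0; so the second derivative of its logarithm is bounded.
\<close>
lemma ln_circulant_symbol_smooth:
  obtains g' g'' :: "real \<Rightarrow> real" and M :: real where
    "\<And>x. ((\<lambda>t. ln (circulant_symbol S t)) has_real_derivative g' x) (at x)"
    "\<And>x. (g' has_real_derivative g'' x) (at x)"
    "\<And>x. \<bar>g'' x\<bar> \<le> M"
proof -
  define q where "q = circulant_symbol S"
  define q' where "q' t = (\<Sum>a\<in>S. 2 * (2 * pi * real a) * sin (2 * pi * real a * t))" for t
  define q'' where "q'' t = (\<Sum>a\<in>S. 2 * (2 * pi * real a)\<^sup>2 * cos (2 * pi * real a * t))" for t
  define B where "B = (\<Sum>a\<in>S. 2 * (2 * pi * real a))"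
  define C where "C = (\<Sum>a\<in>S. 2 * (2 * pi * real a)\<^sup>2)"
  have q: "(q has_real_derivative q' x) (at x)" for x
    unfolding q_def circulant_symbol_def q'_def
    by (auto intro!: derivative_eq_intros sum.cong)
  have q': "(q' has_real_derivative q'' x) (at x)" for x
    unfolding q'_def q''_def
    by (auto intro!: derivative_eq_intros sum.cong simp: power2_eq_square)
  have q1: "1 \<le> q x" for x by (simp add: q_def circulant_symbol_ge_1)
  have B: "\<bar>q' x\<bar> \<le> B" for x
    unfolding q'_def B_def
    by (rule order_trans[OF sum_abs]) (auto intro!: sum_mono simp: abs_mult mult_le_one mult_left_le)
  have C: "\<bar>q'' x\<bar> \<le> C" for x
    unfolding q''_def C_def
    by (rule order_trans[OF sum_abs]) (auto intro!: sum_mono simp: abs_mult mult_left_le)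
  have "((\<lambda>t. ln (circulant_symbol S t)) has_real_derivative q' x / q x) (at x)" for x
    unfolding q_def[symmetric] using q1[of x]
    by (auto intro!: derivative_eq_intros q)
  moreover have "((\<lambda>x. q' x / q x) has_real_derivative q'' x / q x - (q' x / q x)\<^sup>2) (at x)" for x
    using q1[of x] by (auto intro!: derivative_eq_intros q q' simp: field_simps power2_eq_square)
  moreover have "\<bar>q'' x / q x - (q' x / q x)\<^sup>2\<bar> \<le> C + B\<^sup>2" for x
  proof -
    have le: "\<bar>y / q x\<bar> \<le> \<bar>y\<bar>" for y
    proof -
      have "\<bar>y\<bar> / q x \<le> \<bar>y\<bar> / 1" using q1[of x] by (intro divide_left_mono) auto
      then show ?thesis using q1[of x] by (simp add: abs_divide)
    qed
    have "\<bar>q'' x / q x - (q' x / q x)\<^sup>2\<bar> \<le> \<bar>q'' x / q x\<bar> + \<bar>q' x / q x\<bar>\<^sup>2"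
      using abs_triangle_ineq4[of "q'' x / q x" "(q' x / q x)\<^sup>2"]
      by (simp only: power2_abs abs_power2)
    also have "\<dots> \<le> C + B\<^sup>2"
      using le[of "q'' x"] le[of "q' x"] B[of x] C[of x] by (intro add_mono power_mono) auto
    finally show ?thesis .
  qed
  ultimately show ?thesis by (rule that)
qed

section \<open>Asymptotics of the number of forests\<close>

lemma card_forests_circulant_symbol:
  assumes "circulant n S"
  shows "real (card (rooted_spanning_forests (circulant_graph n S))) =
    (\<Prod>j<n. circulant_symbol S (real j / real n))"
proof -
  interpret circulant n S by fact
  have "complex_of_real (real (card (rooted_spanning_forests (circulant_graph n S)))) =
      (\<Prod>j<n. complex_of_real (circulant_symbol S (real j / real n)))"
    unfolding circulant_symbol_complex[symmetric]
    using card_forests_circulant by (simp add: atLeast0LessThan)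
  then have "complex_of_real (real (card (rooted_spanning_forests (circulant_graph n S)))) =
      complex_of_real (\<Prod>j<n. circulant_symbol S (real j / real n))"
    by (simp only: of_real_prod)
  then show ?thesis by (simp only: of_real_eq_iff)
qed

theorem theorem5:
  fixes k :: nat and s :: "nat \<Rightarrow> nat" and f :: "nat \<Rightarrow> nat"
  assumes "k \<ge> 1" and "1 \<le> s 1" and "strict_mono_on {1..k} s"
    and "\<And>n. real (s k) < real n / 2 \<Longrightarrow>
           f n = card (rooted_spanning_forests (circulant_graph n (s ` {1..k})))"
  shows "complex_of_real (laurent_mahler_measure (circulant_laurent k s)) =
           exp (integral {0..1}
             (\<lambda>t. Ln (circulant_laurent k s (exp (2 * of_real pi * \<i> * of_real t)))))
       \<and> (\<lambda>n. real (f n)) \<sim>[at_top] (\<lambda>n. laurent_mahler_measure (circulant_laurent k s) ^ n)"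
proof -
  define S where "S = s ` {1..k}"
  define g where "g t = ln (circulant_symbol S t)" for t
  define I where "I = integral {0..1} g"
  have inj: "inj_on s {1..k}" using assms(3) by (rule strict_mono_on_imp_inj_on)
  have symbol: "circulant_laurent k s (exp (2 * of_real pi * \<i> * of_real t)) =
      complex_of_real (circulant_symbol S t)" for t
    unfolding S_def by (rule circulant_laurent_unit_circle[OF inj])
  have pos: "0 < circulant_symbol S t" for t
    using circulant_symbol_ge_1[of S t] by linarith
  obtain g' g'' M where smooth: "\<And>x. (g has_real_derivative g' x) (at x)"
      "\<And>x. (g' has_real_derivative g'' x) (at x)" "\<And>x. \<bar>g'' x\<bar> \<le> M"
    using ln_circulant_symbol_smooth[of S] unfolding g_def by blast
  have mahler: "laurent_mahler_measure (circulant_laurent k s) = exp I"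
    unfolding laurent_mahler_measure_def symbol I_def g_def using pos by (simp add: abs_of_pos)
  have "g integrable_on {0..1}"
    by (intro integrable_continuous_real DERIV_continuous_on) (blast intro: DERIV_subset smooth(1))
  then have "((\<lambda>t. complex_of_real (g t)) has_integral of_real I) {0..1}"
    unfolding I_def by (intro has_integral_of_real integrable_integral)
  moreover have "(\<lambda>t. Ln (circulant_laurent k s (exp (2 * of_real pi * \<i> * of_real t)))) =
      (\<lambda>t. complex_of_real (g t))"
    unfolding symbol g_def by (simp only: Ln_of_real[OF pos])
  ultimately have "complex_of_real (laurent_mahler_measure (circulant_laurent k s)) =
      exp (integral {0..1} (\<lambda>t. Ln (circulant_laurent k s (exp (2 * of_real pi * \<i> * of_real t)))))"
    unfolding mahler by (simp only: integral_unique exp_of_real)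
  moreover have "(\<lambda>n. real (f n)) \<sim>[at_top] (\<lambda>n. laurent_mahler_measure (circulant_laurent k s) ^ n)"
  proof (rule asymp_equivI')
    have jumps: "1 \<le> a \<and> a \<le> s k" if a: "a \<in> S" for a
    proof -
      have mono: "s i \<le> s j" if "i \<in> {1..k}" "j \<in> {1..k}" "i \<le> j" for i j
        using strict_mono_on_leD[OF assms(3) that] .
      obtain i where "i \<in> {1..k}" "a = s i" using a unfolding S_def by blast
      then show ?thesis using mono[of 1 i] mono[of i k] assms(1,2) by auto
    qed
    have quotient: "real (f n) / laurent_mahler_measure (circulant_laurent k s) ^ n =
        exp ((\<Sum>j<n. g (real j / real n)) - real n * I)" if n: "2 * s k < n" for n
    proof -
      have "circulant n S"
        using jumps n by unfold_locales fastforce+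
      then have "real (f n) = (\<Prod>j<n. circulant_symbol S (real j / real n))"
        using assms(4)[of n] n card_forests_circulant_symbol[of n S] by (simp add: S_def)
      also have "\<dots> = exp (\<Sum>j<n. g (real j / real n))"
        using pos by (simp add: exp_sum g_def)
      finally show ?thesis
        unfolding mahler by (simp add: exp_diff exp_of_nat_mult)
    qed
    have "g 1 = g 0"
    proof -
      have "cos (2 * pi * real a) = 1" for a
        using cos_int_2pin[of "int a"] by (simp add: mult.assoc)
      then show ?thesis by (simp add: g_def circulant_symbol_def)
    qed
    then have "(\<lambda>n. exp ((\<Sum>j<n. g (real j / real n)) - real n * I)) \<longlonglongrightarrow> exp 0"
      unfolding I_def
      by (intro tendsto_exp periodic_riemann_sum_error_tendsto_0[OF smooth])
    moreover have "\<forall>\<^sub>F n in sequentially. real (f n) / laurent_mahler_measure (circulant_laurent k s) ^ n =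
        exp ((\<Sum>j<n. g (real j / real n)) - real n * I)"
      by (rule eventually_mono[OF eventually_gt_at_top[of "2 * s k"]]) (rule quotient)
    ultimately show "(\<lambda>n. real (f n) / laurent_mahler_measure (circulant_laurent k s) ^ n) \<longlonglongrightarrow> 1"
      by (simp only: exp_zero tendsto_cong)
  qed
  ultimately show ?thesis by blast
qed

end
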